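(* Let $M_{1}\geq0$ and $M_{2}>0$ be constants, let $g:\overline{\mathbb{D}}\to\mathbb{C}$ be continuous with $\|g\|_{\infty}\leq M_{1}$, and let $f\in\mathcal{F}_{g}(\overline{\mathbb{D}})$ satisfy $\|f\|_{\infty}\leq M_{2}$. Then there is an $r_{0}\in(0,1)$ such that $f$ is bi-Lipschitz in $\mathbb{D}_{r_{0}}$.
   Context: $\mathbb{D}_{r}=\{z\in\mathbb{C}:|z|<r\}$, $\mathbb{D}=\mathbb{D}_1$. For $g$ continuous on $\overline{\mathbb{D}}$, $\mathcal{F}_{g}(\overline{\mathbb{D}})$ denotes the class of all complex-valued functions $f$ that are continuous on $\overline{\mathbb{D}}$ and twice continuously differentiable in $\mathbb{D}$, satisfying $\Delta f=g$ in $\mathbb{D}$ and $f(0)=J_{f}(0)-1=0$. Here $\Delta f=f_{xx}+f_{yy}$ for $z=x+iy$, and $J_{f}=|f_{z}|^{2}-|f_{\overline{z}}|^{2}$ is the Jacobian determinant of $f$, with $f_z=\frac12(f_x-if_y)$, $f_{\overline z}=\frac12(f_x+if_y)$. Norms: $\|g\|_{\infty}=\sup_{z\in\mathbb{D}}|g(z)|$, $\|f\|_{\infty}=\sup_{z\in\mathbb{D}}|f(z)|$. Bi-Lipschitz in $\mathbb{D}_{r_0}$ means there are constants $L_1,L_2>0$ with $L_1|z_1-z_2|\le|f(z_1)-f(z_2)|\le L_2|z_1-z_2|$ for all $z_1,z_2\in\mathbb{D}_{r_0}$. *)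

theory Defs
  imports "HOL-Analysis.Analysis"
begin

text \<open>
  Partial derivatives of \<open>f\<close> with \<open>z = x + i y\<close>: the real Frechet derivative of \<open>f\<close> at \<open>z\<close> in the
  directions \<open>1\<close> and \<open>\<i>\<close>. The values are unspecified at points where \<open>f\<close> is not real differentiable.
\<close>

definition partial_x :: "(complex \<Rightarrow> complex) \<Rightarrow> complex \<Rightarrow> complex" where
  "partial_x f z = frechet_derivative f (at z) 1"

definition partial_y :: "(complex \<Rightarrow> complex) \<Rightarrow> complex \<Rightarrow> complex" where
  "partial_y f z = frechet_derivative f (at z) \<i>"

definition wirtinger :: "(complex \<Rightarrow> complex) \<Rightarrow> complex \<Rightarrow> complex" where
  "wirtinger f z = (partial_x f z - \<i> * partial_y f z) / 2"

definition wirtinger_bar :: "(complex \<Rightarrow> complex) \<Rightarrow> complex \<Rightarrow> complex" where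
  "wirtinger_bar f z = (partial_x f z + \<i> * partial_y f z) / 2"

definition jacobian_det :: "(complex \<Rightarrow> complex) \<Rightarrow> complex \<Rightarrow> real" where
  "jacobian_det f z = (cmod (wirtinger f z))\<^sup>2 - (cmod (wirtinger_bar f z))\<^sup>2"

definition laplacian :: "(complex \<Rightarrow> complex) \<Rightarrow> complex \<Rightarrow> complex" where
  "laplacian f z = partial_x (partial_x f) z + partial_y (partial_y f) z"

text \<open>Real \<open>C\<^sup>1\<close> and \<open>C\<^sup>2\<close> smoothness; intended for open \<open>S\<close>, since full neighbourhoods are used.\<close>

definition C1_on :: "complex set \<Rightarrow> (complex \<Rightarrow> complex) \<Rightarrow> bool" where
  "C1_on S f \<longleftrightarrow> (\<forall>z\<in>S. f differentiable (at z)) \<and>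
     continuous_on S (partial_x f) \<and> continuous_on S (partial_y f)"

definition C2_on :: "complex set \<Rightarrow> (complex \<Rightarrow> complex) \<Rightarrow> bool" where
  "C2_on S f \<longleftrightarrow> C1_on S f \<and> C1_on S (partial_x f) \<and> C1_on S (partial_y f)"

text \<open>
  The supremum is taken in \<open>real\<close>, so it is meaningful only for functions bounded on the open unit
  disc, in particular for those continuous on the closed disc.
\<close>

definition disc_sup_norm :: "(complex \<Rightarrow> complex) \<Rightarrow> real" where
  "disc_sup_norm f = (SUP z\<in>ball 0 1. cmod (f z))"

text \<open>
  Functions on the closed disc are represented by total functions; the conditions below depend only
  on the values on the closed disc.
\<close>

definition poisson_class :: "(complex \<Rightarrow> complex) \<Rightarrow> (complex \<Rightarrow> complex) set" where
  "poisson_class g = {f. continuous_on (cball 0 1) f \<and> C2_on (ball 0 1) f \<and>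
     (\<forall>z\<in>ball 0 1. laplacian f z = g z) \<and> f 0 = 0 \<and> jacobian_det f 0 - 1 = 0}"

definition bi_lipschitz_on :: "complex set \<Rightarrow> (complex \<Rightarrow> complex) \<Rightarrow> bool" where
  "bi_lipschitz_on S f \<longleftrightarrow> (\<exists>L1>0. \<exists>L2>0. \<forall>z1\<in>S. \<forall>z2\<in>S.
     L1 * cmod (z1 - z2) \<le> cmod (f z1 - f z2) \<and> cmod (f z1 - f z2) \<le> L2 * cmod (z1 - z2))"

end

theory Submission
  imports Defs
begin

text \<open>
  Write the derivative of \<open>f\<close> at \<open>0\<close> as \<open>A h = a h + b \<bar>h\<close> with Wirtinger coefficients \<open>a\<close>, \<open>b\<close>.
  The Jacobian condition gives \<open>|a| > |b|\<close>, hence \<open>|A h| \<ge> (|a| - |b|) |h|\<close>, while by continuity of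
  the partial derivatives \<open>f - A\<close> has a small Lipschitz constant near \<open>0\<close>.
\<close>

text \<open>The Frechet derivative is real linear, so its values at \<open>1\<close> and
  \<open>\<i>\<close> determine it; differentiability is what gives these values meaning.\<close>

lemma has_derivative_partials:
  assumes "f differentiable (at z)"
  shows "(f has_derivative (\<lambda>h. of_real (Re h) * partial_x f z + of_real (Im h) * partial_y f z)) (at z)"
proof -
  let ?D = "frechet_derivative f (at z)"
  interpret linear ?D
    using assms by (rule linear_frechet_derivative)
  have "?D h = of_real (Re h) * partial_x f z + of_real (Im h) * partial_y f z" for h
  proof -
    have "?D h = ?D (Re h *\<^sub>R 1 + Im h *\<^sub>R \<i>)"
      by (rule arg_cong[of _ _ ?D]) (simp add: complex_eq_iff)
    also have "\<dots> = Re h *\<^sub>R ?D 1 + Im h *\<^sub>R ?D \<i>"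
      by (simp only: add scale)
    finally show ?thesis
      by (simp add: partial_x_def partial_y_def scaleR_conv_of_real)
  qed
  then have "?D = (\<lambda>h. of_real (Re h) * partial_x f z + of_real (Im h) * partial_y f z)"
    by (rule ext)
  then show ?thesis
    using assms frechet_derivative_works by metis
qed

lemma partials_eq_wirtinger:
  "of_real (Re h) * partial_x f z + of_real (Im h) * partial_y f z
     = wirtinger f z * h + wirtinger_bar f z * cnj h"
  by (simp add: wirtinger_def wirtinger_bar_def complex_eq_iff field_simps)

text \<open>The bound is claimed for every \<open>s \<le> r\<close> so that the radius can later be
  shrunk freely; for \<open>s \<le> 0\<close> the ball is empty.\<close>

lemma C1_on_imp_bi_lipschitz_near:
  assumes S: "open S" "z0 \<in> S" and f: "C1_on S f" and J: "jacobian_det f z0 > 0"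
  shows "\<exists>r>0. \<forall>s\<le>r. bi_lipschitz_on (ball z0 s) f"
proof -
  define a b where "a = wirtinger f z0" and "b = wirtinger_bar f z0"
  \<comment> \<open>The smaller singular value of \<open>A\<close>, that is, the best constant in
    \<open>c * cmod h \<le> cmod (A h)\<close>.\<close>
  define c where "c = cmod a - cmod b"
  define A where "A = (\<lambda>h. of_real (Re h) * partial_x f z0 + of_real (Im h) * partial_y f z0)"
  have "(cmod b)\<^sup>2 < (cmod a)\<^sup>2"
    using J by (simp add: jacobian_det_def a_def b_def)
  then have c: "c > 0"
    unfolding c_def using power2_less_imp_less[of "cmod b" "cmod a"] by simp
  have A_eq: "A h = a * h + b * cnj h" for h
    unfolding A_def a_def b_def by (rule partials_eq_wirtinger)
  \<comment> \<open>Here \<open>a * h = A h - b * cnj h\<close>, and conjugation preserves the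
    modulus.\<close>
  have A_lower: "c * cmod h \<le> cmod (A h)" for h
    using norm_triangle_ineq4[of "A h" "b * cnj h"]
    by (simp add: A_eq c_def norm_mult algebra_simps)
  have A_upper: "cmod (A h) \<le> (cmod a + cmod b) * cmod h" for h
    using norm_triangle_ineq[of "a * h" "b * cnj h"]
    by (simp add: A_eq norm_mult algebra_simps)
  have A_diff: "A (x - y) = A x - A y" for x y
    by (simp add: A_def algebra_simps)
  have A_bl: "bounded_linear A"
    unfolding A_def by (intro bounded_linear_intros bounded_linear_of_real[THEN bounded_linear_compose]
        bounded_linear_Re bounded_linear_Im)

  have diff: "f differentiable (at z)" if "z \<in> S" for z
    using f that by (simp add: C1_on_def)
  have "continuous (at z0) (partial_x f)" "continuous (at z0) (partial_y f)"
    using f S by (auto simp: C1_on_def continuous_on_eq_continuous_at)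
  \<comment> \<open>Full rather than punctured neighbourhoods, so that the estimates hold on a whole
    ball, centre included.\<close>
  then have "(partial_x f \<longlongrightarrow> partial_x f z0) (nhds z0)" "(partial_y f \<longlongrightarrow> partial_y f z0) (nhds z0)"
    by (simp_all add: continuous_at tendsto_at_iff_tendsto_nhds)
  \<comment> \<open>The tolerance \<open>c/4\<close> for each of the two partials adds up to the
    Lipschitz constant \<open>c/2\<close> for \<open>f - A\<close>, half of what \<open>A\<close>
    can absorb.\<close>
  then have "eventually (\<lambda>z. dist (partial_x f z) (partial_x f z0) < c/4) (nhds z0)"
    "eventually (\<lambda>z. dist (partial_y f z) (partial_y f z0) < c/4) (nhds z0)"
    using c by (auto intro!: tendstoD simp del: less_divide_eq_numeral1)
  moreover have "eventually (\<lambda>z. z \<in> S) (nhds z0)"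
    using S by (rule eventually_nhds_in_open)
  ultimately have "eventually (\<lambda>z. z \<in> S \<and> dist (partial_x f z) (partial_x f z0) < c/4
      \<and> dist (partial_y f z) (partial_y f z0) < c/4) (nhds z0)"
    by eventually_elim simp
  then obtain r where r: "r > 0" and
    near: "\<And>z. z \<in> ball z0 r \<Longrightarrow> z \<in> S \<and> cmod (partial_x f z - partial_x f z0) < c/4
      \<and> cmod (partial_y f z - partial_y f z0) < c/4"
    by (auto simp: eventually_nhds_metric dist_norm norm_minus_commute)

  \<comment> \<open>Mean value inequality on the convex ball; \<open>A\<close> is linear and hence
    its own derivative at every point.\<close>
  have lip: "cmod ((f x - A x) - (f y - A y)) \<le> c/2 * cmod (x - y)"
    if "x \<in> ball z0 r" "y \<in> ball z0 r" for x y
  proof (rule differentiable_bound[OF convex_ball _ _ that])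
    fix z assume z: "z \<in> ball z0 r"
    let ?D = "\<lambda>h. of_real (Re h) * partial_x f z + of_real (Im h) * partial_y f z"
    show "((\<lambda>z. f z - A z) has_derivative (\<lambda>h. ?D h - A h)) (at z within ball z0 r)"
      using near[OF z]
      by (intro has_derivative_diff has_derivative_at_withinI[OF has_derivative_partials]
          bounded_linear_imp_has_derivative A_bl diff) simp
    show "onorm (\<lambda>h. ?D h - A h) \<le> c/2"
    proof (rule onorm_le)
      fix h
      have "?D h - A h = of_real (Re h) * (partial_x f z - partial_x f z0)
          + of_real (Im h) * (partial_y f z - partial_y f z0)"
        by (simp add: A_def algebra_simps)
      then have "cmod (?D h - A h) \<le> \<bar>Re h\<bar> * cmod (partial_x f z - partial_x f z0)
          + \<bar>Im h\<bar> * cmod (partial_y f z - partial_y f z0)"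
        by (metis norm_mult norm_of_real norm_triangle_ineq)
      also have "\<dots> \<le> cmod h * (c/4) + cmod h * (c/4)"
        using near[OF z] by (intro add_mono mult_mono abs_Re_le_cmod abs_Im_le_cmod) auto
      finally show "cmod (?D h - A h) \<le> c/2 * cmod h"
        by simp
    qed
  qed
  have "bi_lipschitz_on (ball z0 s) f" if "s \<le> r" for s
    unfolding bi_lipschitz_on_def
  proof (intro exI conjI ballI)
    \<comment> \<open>The bounds \<open>c\<close> and \<open>cmod a + cmod b\<close> for
      \<open>A\<close>, each worsened by the perturbation \<open>c/2\<close>.\<close>
    show "c/2 > 0" "cmod a + cmod b + c/2 > 0"
      using c by (auto simp: add_nonneg_pos)
    fix x y assume "x \<in> ball z0 s" "y \<in> ball z0 s"
    then have "cmod ((f x - f y) - A (x - y)) \<le> c/2 * cmod (x - y)"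
      using lip[of x y] \<open>s \<le> r\<close> by (simp add: A_diff algebra_simps)
    moreover have "cmod (A (x - y)) - cmod (f x - f y) \<le> cmod ((f x - f y) - A (x - y))"
      by (metis norm_minus_commute norm_triangle_ineq2)
    moreover have "cmod (f x - f y) - cmod (A (x - y)) \<le> cmod ((f x - f y) - A (x - y))"
      by (rule norm_triangle_ineq2)
    ultimately show "c/2 * cmod (x - y) \<le> cmod (f x - f y)"
      "cmod (f x - f y) \<le> (cmod a + cmod b + c/2) * cmod (x - y)"
      using A_lower[of "x - y"] A_upper[of "x - y"] by (simp_all add: algebra_simps)
  qed
  with r show ?thesis
    by blast
qed

theorem corollary1:
  fixes M1 M2 :: real and f g :: "complex \<Rightarrow> complex"
  assumes "M1 \<ge> 0" and "M2 > 0"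
    and "continuous_on (cball 0 1) g" and "disc_sup_norm g \<le> M1"
    and "f \<in> poisson_class g" and "disc_sup_norm f \<le> M2"
  shows "\<exists>r0. 0 < r0 \<and> r0 < 1 \<and> bi_lipschitz_on (ball 0 r0) f"
proof -
  have "C1_on (ball 0 1) f" "jacobian_det f 0 > 0"
    using assms(5) by (auto simp: poisson_class_def C2_on_def)
  then obtain r where "r > 0" "\<forall>s\<le>r. bi_lipschitz_on (ball 0 s) f"
    using C1_on_imp_bi_lipschitz_near[of "ball 0 1" 0 f] by auto
  then show ?thesis
    \<comment> \<open>The minimum with \<open>1/2\<close> keeps the radius below 1.\<close>
    by (intro exI[of _ "min r (1/2)"]) auto
qed

end
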